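(* Let $\mathbb{F}_q$ be a finite field with $q$ elements, let $\Psi:\mathbb{F}_q\to\mathbb{C}$ be a nontrivial additive character, and let $n,N\ge 1$ be integers. For every set $A=\{\mathbf{a}_1,\dots,\mathbf{a}_N\}\subseteq(\mathbb{Z}/(q-1)\mathbb{Z})^n$, every $\beta=(\beta_1,\dots,\beta_n)\in(\widehat{\mathbb{F}_q^\times})^n$, and every $\lambda=(\lambda_1,\dots,\lambda_N)\in(\mathbb{F}_q^\times)^N$, $$S_A(\beta,\lambda)=F_A(\beta;\lambda),$$ that is, $$\sum_{x=(x_1,\dots,x_n)\in(\mathbb{F}_q^\times)^n}\bar\beta_1(x_1)\cdots\bar\beta_n(x_n)\,\Psi\bigg(\sum_{i=1}^N\lambda_i x^{\mathbf{a}_i}\bigg)=(q-1)^{n-N}\sum_{\chi=(\chi_1,\dots,\chi_N)\in L_\beta}g(\bar\chi_1)\cdots g(\bar\chi_N)\,\chi_1(\lambda_1)\cdots\chi_N(\lambda_N).$$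
   Context: $q=p^a$ with $p$ prime. $\widehat{\mathbb{F}_q^\times}$ is the group of multiplicative characters $\chi:\mathbb{F}_q^\times\to\mathbb{C}^\times$, and $\bar\chi$ denotes the complex conjugate (equivalently, inverse) of $\chi$. For $\chi\in\widehat{\mathbb{F}_q^\times}$ the Gauss sum is $g(\chi)=\sum_{x\in\mathbb{F}_q^\times}\chi(x)\Psi(x)\in\mathbb{C}$. For $\chi\in\widehat{\mathbb{F}_q^\times}$ and $\mathbf{b}=(b_1,\dots,b_n)\in(\mathbb{Z}/(q-1)\mathbb{Z})^n$, put $\chi^{\mathbf{b}}=(\chi^{b_1},\dots,\chi^{b_n})\in(\widehat{\mathbb{F}_q^\times})^n$. Products in $(\widehat{\mathbb{F}_q^\times})^n$ are componentwise. For $x=(x_1,\dots,x_n)\in(\mathbb{F}_q^\times)^n$ and $\mathbf{a}=(a_1,\dots,a_n)\in(\mathbb{Z}/(q-1)\mathbb{Z})^n$, put $x^{\mathbf{a}}=x_1^{a_1}\cdots x_n^{a_n}$. Given $A=\{\mathbf{a}_1,\dots,\mathbf{a}_N\}$ and $\beta$, define $$L_\beta=\Big\{\chi=(\chi_1,\dots,\chi_N)\in(\widehat{\mathbb{F}_q^\times})^N \;\Big|\; \prod_{i=1}^N\chi_i^{\mathbf{a}_i}=\beta\Big\}.$$ The finite field $A$-hypergeometric function $F_A(\beta;-):(\mathbb{F}_q^\times)^N\to\mathbb{C}$ is $$F_A(\beta;\lambda)=(q-1)^{n-N}\sum_{\chi\in L_\beta}g(\bar\chi_1)\cdots g(\bar\chi_N)\,\chi_1(\lambda_1)\cdots\chi_N(\lambda_N),$$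 and the associated exponential sum is $$S_A(\beta,\lambda)=\sum_{x\in(\mathbb{F}_q^\times)^n}\bar\beta_1(x_1)\cdots\bar\beta_n(x_n)\,\Psi\Big(\sum_{i=1}^N\lambda_i x^{\mathbf{a}_i}\Big).$$ *)

theory Defs
  imports Complex_Main "HOL-Library.FuncSet" "HOL-Library.Cardinality" "HOL-Number_Theory.Cong"
begin

text \<open>
  The finite field is a type of sort \<open>{field, finite}\<close>, its unit group is \<open>- {0}\<close>, and
  \<open>n\<close>-tuples are functions on \<open>{1..n}\<close>, extensional whenever one sums over a set of tuples.

  An element of \<open>\<int>/(q-1)\<int>\<close> is given by an arbitrary integer representative.  The congruence
  lemmas below show that every definition depends only on the residue classes modulo \<open>q-1\<close>.
\<close>

definition add_char :: "('a::{field,finite} \<Rightarrow> complex) \<Rightarrow> bool" where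
  "add_char \<Psi> \<longleftrightarrow> (\<forall>x. \<Psi> x \<noteq> 0) \<and> (\<forall>x y. \<Psi> (x + y) = \<Psi> x * \<Psi> y)"

definition nontrivial_add_char :: "('a::{field,finite} \<Rightarrow> complex) \<Rightarrow> bool" where
  "nontrivial_add_char \<Psi> \<longleftrightarrow> add_char \<Psi> \<and> (\<exists>x. \<Psi> x \<noteq> 1)"

text \<open>
  A character of the unit group is stored as a function on the whole field.  The condition
  \<open>\<chi> 0 = 0\<close> only makes this encoding unique (the trivial character also vanishes at \<open>0\<close>); it
  is needed because we sum over sets of characters.
\<close>
definition mult_chars :: "('a::{field,finite} \<Rightarrow> complex) set" where
  "mult_chars = {\<chi>. \<chi> 0 = 0 \<and> (\<forall>x\<in>-{0}. \<chi> x \<noteq> 0) \<and>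
                     (\<forall>x\<in>-{0}. \<forall>y\<in>-{0}. \<chi> (x * y) = \<chi> x * \<chi> y)}"

definition char_cnj :: "('a::{field,finite} \<Rightarrow> complex) \<Rightarrow> 'a \<Rightarrow> complex" where
  "char_cnj \<chi> = (\<lambda>x. cnj (\<chi> x))"

text \<open>The case distinction is for exponent \<open>0\<close>, as \<open>0 powi 0 = 1\<close>.\<close>
definition char_pow :: "('a::{field,finite} \<Rightarrow> complex) \<Rightarrow> int \<Rightarrow> 'a \<Rightarrow> complex" where
  "char_pow \<chi> k = (\<lambda>x. if x = 0 then 0 else \<chi> x powi k)"

definition gauss_sum :: "('a::{field,finite} \<Rightarrow> complex) \<Rightarrow> ('a \<Rightarrow> complex) \<Rightarrow> complex" where
  "gauss_sum \<Psi> \<chi> = (\<Sum>x\<in>-{0}. \<chi> x * \<Psi> x)"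

definition monom_eval :: "nat \<Rightarrow> (nat \<Rightarrow> 'a::{field,finite}) \<Rightarrow> (nat \<Rightarrow> int) \<Rightarrow> 'a" where
  "monom_eval n x a = (\<Prod>j\<in>{1..n}. x j powi a j)"

text \<open>
  In the following, \<open>a i\<close> is the \<open>i\<close>-th exponent vector and \<open>a i j\<close> its \<open>j\<close>-th entry.  The
  equation between \<open>n\<close>-tuples of characters that defines \<open>L\<^sub>\<beta>\<close> is written out entry by entry,
  and each entry as an equality of functions on the unit group.
\<close>
definition L_set ::
  "nat \<Rightarrow> nat \<Rightarrow> (nat \<Rightarrow> nat \<Rightarrow> int) \<Rightarrow> (nat \<Rightarrow> 'a::{field,finite} \<Rightarrow> complex)
    \<Rightarrow> (nat \<Rightarrow> 'a \<Rightarrow> complex) set" where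
  "L_set n N a \<beta> =
    {\<chi> \<in> {1..N} \<rightarrow>\<^sub>E mult_chars.
       \<forall>j\<in>{1..n}. \<forall>x\<in>-{0}. (\<Prod>i\<in>{1..N}. char_pow (\<chi> i) (a i j) x) = \<beta> j x}"

definition F_A ::
  "('a::{field,finite} \<Rightarrow> complex) \<Rightarrow> nat \<Rightarrow> nat \<Rightarrow> (nat \<Rightarrow> nat \<Rightarrow> int)
    \<Rightarrow> (nat \<Rightarrow> 'a \<Rightarrow> complex) \<Rightarrow> (nat \<Rightarrow> 'a) \<Rightarrow> complex" where
  "F_A \<Psi> n N a \<beta> l =
    (of_nat CARD('a) - 1) powi (int n - int N) *
    (\<Sum>\<chi>\<in>L_set n N a \<beta>.
       (\<Prod>i\<in>{1..N}. gauss_sum \<Psi> (char_cnj (\<chi> i))) * (\<Prod>i\<in>{1..N}. \<chi> i (l i)))"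

definition S_A ::
  "('a::{field,finite} \<Rightarrow> complex) \<Rightarrow> nat \<Rightarrow> nat \<Rightarrow> (nat \<Rightarrow> nat \<Rightarrow> int)
    \<Rightarrow> (nat \<Rightarrow> 'a \<Rightarrow> complex) \<Rightarrow> (nat \<Rightarrow> 'a) \<Rightarrow> complex" where
  "S_A \<Psi> n N a \<beta> l =
    (\<Sum>x\<in>{1..n} \<rightarrow>\<^sub>E -{0}.
       (\<Prod>j\<in>{1..n}. char_cnj (\<beta> j) (x j)) * \<Psi> (\<Sum>i\<in>{1..N}. l i * monom_eval n x (a i)))"

lemma unit_power_card:
  fixes x :: "'a::{field,finite}"
  assumes "x \<noteq> 0"
  shows "x ^ (CARD('a) - 1) = 1"
proof -
  have "bij_betw ((*) x) (-{0}) (-{0})"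
    by (rule bij_betw_byWitness[where f' = "\<lambda>y. y / x"]) (use assms in auto)
  hence "(\<Prod>y\<in>-{0}. x * y) = (\<Prod>y\<in>-{0::'a}. y)"
    by (rule prod.reindex_bij_betw[where g = "\<lambda>y. y", simplified])
  moreover have "(\<Prod>y\<in>-{0}. x * y) = x ^ card (-{0::'a}) * (\<Prod>y\<in>-{0::'a}. y)"
    by (simp add: prod.distrib)
  moreover have "card (-{0::'a}) = CARD('a) - 1"
    by (simp add: Compl_eq_Diff_UNIV card_Diff_singleton)
  moreover have "(\<Prod>y\<in>-{0::'a}. y) \<noteq> 0"
    by simp
  ultimately show ?thesis
    by simp
qed

lemma powi_cong_aux:
  fixes z :: "'b::field"
  assumes "z \<noteq> 0" "z ^ m = 1" "[k = l] (mod int m)"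
  shows "z powi k = z powi l"
proof -
  obtain d where d: "k = l + int m * d"
    using assms(3) by (metis cong_iff_lin cong_sym)
  have "z powi (int m * d) = 1"
    using assms by (simp add: power_int_mult)
  thus ?thesis
    using assms(1) d by (simp add: power_int_add)
qed

lemma unit_powi_cong:
  fixes x :: "'a::{field,finite}"
  assumes "x \<noteq> 0" "[k = l] (mod int (CARD('a) - 1))"
  shows "x powi k = x powi l"
  using powi_cong_aux[OF assms(1) unit_power_card[OF assms(1)] assms(2)] .

lemma char_pow_cong:
  fixes \<chi> :: "'a::{field,finite} \<Rightarrow> complex"
  assumes "\<chi> \<in> mult_chars" "[k = l] (mod int (CARD('a) - 1))"
  shows "char_pow \<chi> k = char_pow \<chi> l"
proof
  fix x :: 'a
  have "\<chi> x powi k = \<chi> x powi l" if "x \<noteq> 0"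
  proof (rule powi_cong_aux[OF _ _ assms(2)])
    show "\<chi> x \<noteq> 0"
      using assms(1) that by (auto simp: mult_chars_def)
    have mult: "\<chi> (u * v) = \<chi> u * \<chi> v" if "u \<noteq> 0" "v \<noteq> 0" for u v
      using assms(1) that by (auto simp: mult_chars_def)
    have "\<chi> 1 \<noteq> 0"
      using assms(1) by (auto simp: mult_chars_def)
    hence one: "\<chi> 1 = 1"
      using mult[of 1 1] by simp
    have "\<chi> (x ^ m) = \<chi> x ^ m" for m
      by (induction m) (use that one mult in auto)
    thus "\<chi> x ^ (CARD('a) - 1) = 1"
      using unit_power_card[OF that] one by metis
  qed
  thus "char_pow \<chi> k x = char_pow \<chi> l x"
    by (simp add: char_pow_def)
qed

lemma L_set_cong:
  fixes \<beta> :: "nat \<Rightarrow> 'a::{field,finite} \<Rightarrow> complex"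
  assumes "\<And>i j. i \<in> {1..N} \<Longrightarrow> j \<in> {1..n} \<Longrightarrow> [a i j = b i j] (mod int (CARD('a) - 1))"
  shows "L_set n N a \<beta> = L_set n N b \<beta>"
proof -
  have "(\<Prod>i\<in>{1..N}. char_pow (\<chi> i) (a i j) x) = (\<Prod>i\<in>{1..N}. char_pow (\<chi> i) (b i j) x)"
    if "\<chi> \<in> {1..N} \<rightarrow>\<^sub>E mult_chars" "j \<in> {1..n}" for \<chi> :: "nat \<Rightarrow> 'a \<Rightarrow> complex" and j x
    by (rule prod.cong[OF refl])
      (metis PiE_mem that assms char_pow_cong)
  thus ?thesis
    unfolding L_set_def by (intro Collect_cong conj_cong refl ball_cong) simp_all
qed

lemma F_A_cong:
  fixes \<beta> :: "nat \<Rightarrow> 'a::{field,finite} \<Rightarrow> complex"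
  assumes "\<And>i j. i \<in> {1..N} \<Longrightarrow> j \<in> {1..n} \<Longrightarrow> [a i j = b i j] (mod int (CARD('a) - 1))"
  shows "F_A \<Psi> n N a \<beta> l = F_A \<Psi> n N b \<beta> l"
  using L_set_cong[OF assms, where \<beta> = \<beta>] by (simp add: F_A_def)

lemma S_A_cong:
  fixes \<beta> :: "nat \<Rightarrow> 'a::{field,finite} \<Rightarrow> complex"
  assumes "\<And>i j. i \<in> {1..N} \<Longrightarrow> j \<in> {1..n} \<Longrightarrow> [a i j = b i j] (mod int (CARD('a) - 1))"
  shows "S_A \<Psi> n N a \<beta> l = S_A \<Psi> n N b \<beta> l"
proof -
  have "monom_eval n x (a i) = monom_eval n x (b i)"
    if "x \<in> {1..n} \<rightarrow>\<^sub>E -{0}" "i \<in> {1..N}" for x :: "nat \<Rightarrow> 'a" and i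
    unfolding monom_eval_def
  proof (rule prod.cong[OF refl])
    fix j assume j: "j \<in> {1..n}"
    hence "x j \<noteq> 0"
      using that(1) by (metis ComplD PiE_mem singletonI)
    thus "x j powi a i j = x j powi b i j"
      using assms[OF that(2) j] by (rule unit_powi_cong)
  qed
  hence "(\<Sum>i\<in>{1..N}. l i * monom_eval n x (a i)) = (\<Sum>i\<in>{1..N}. l i * monom_eval n x (b i))"
    if "x \<in> {1..n} \<rightarrow>\<^sub>E -{0}" for x :: "nat \<Rightarrow> 'a"
    using that by (intro sum.cong) simp_all
  thus ?thesis
    unfolding S_A_def by (intro sum.cong) simp_all
qed

end

theory Submission
  imports Defs "HOL-Algebra.Multiplicative_Group"
begin

text \<open>
  Fourier inversion on the cyclic group \<open>- {0}\<close> gives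
  \<open>(q - 1) \<Psi>(y) = (\<Sum>\<chi>. g(cnj \<chi>) \<chi>(y))\<close> for \<open>y \<noteq> 0\<close>.  Write \<open>\<Psi>\<close> of the sum of monomials as a
  product, expand each factor in this way and sum over the \<open>x j\<close> first: by orthogonality only
  the tuples in \<open>L_set\<close> survive, each with a factor \<open>(q - 1)^n\<close>.
\<close>

section \<open>Multiplicative characters\<close>

lemma card_units: "card (-{0::'a::{field,finite}}) = CARD('a) - 1"
  by (simp add: Compl_eq_Diff_UNIV card_Diff_singleton)

lemma card_field_gt_1: "CARD('a::{field,finite}) > 1"
proof -
  have "card {0, 1 :: 'a} \<le> CARD('a)"
    by (rule card_mono) auto
  thus ?thesis by simp
qed

lemma mult_char_0: "\<chi> \<in> mult_chars \<Longrightarrow> \<chi> 0 = 0"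
  by (auto simp: mult_chars_def)

lemma mult_char_nonzero: "\<chi> \<in> mult_chars \<Longrightarrow> x \<noteq> 0 \<Longrightarrow> \<chi> x \<noteq> 0"
  by (auto simp: mult_chars_def)

text \<open>Because \<open>\<chi> 0 = 0\<close>, multiplicativity extends from the units to the
  whole field, so rewriting with it has no side conditions on \<open>x\<close> and
  \<open>y\<close>.\<close>

lemma mult_char_mult: "\<chi> \<in> mult_chars \<Longrightarrow> \<chi> (x * y) = \<chi> x * \<chi> y"
  by (cases "x = 0 \<or> y = 0") (auto simp: mult_chars_def)

lemma mult_char_1: "\<chi> \<in> mult_chars \<Longrightarrow> \<chi> 1 = 1"
  using mult_char_mult[of \<chi> 1 1] mult_char_nonzero[of \<chi> 1] by simp

lemma mult_char_power: "\<chi> \<in> mult_chars \<Longrightarrow> \<chi> (x ^ k) = \<chi> x ^ k"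
  by (induction k) (simp_all add: mult_char_1 mult_char_mult)

lemma mult_char_inverse:
  assumes "\<chi> \<in> mult_chars"
  shows "\<chi> (inverse x) = inverse (\<chi> x)"
proof (cases "x = 0")
  case True
  thus ?thesis by (simp add: mult_char_0[OF assms])
next
  case False
  hence "\<chi> x * \<chi> (inverse x) = 1"
    by (simp add: mult_char_1[OF assms] flip: mult_char_mult[OF assms])
  thus ?thesis by (rule inverse_unique[symmetric])
qed

lemma mult_char_powi: "\<chi> \<in> mult_chars \<Longrightarrow> \<chi> (x powi k) = \<chi> x powi k"
  by (simp add: power_int_def mult_char_power mult_char_inverse)

lemma mult_char_prod: "\<chi> \<in> mult_chars \<Longrightarrow> \<chi> (\<Prod>i\<in>I. f i) = (\<Prod>i\<in>I. \<chi> (f i))"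
  by (induction I rule: infinite_finite_induct) (simp_all add: mult_char_1 mult_char_mult)

section \<open>Unitarity of character values\<close>

lemma mult_char_root_of_unity:
  fixes \<chi> :: "'a::{field,finite} \<Rightarrow> complex"
  assumes "\<chi> \<in> mult_chars" "x \<noteq> 0"
  shows "\<chi> x ^ (CARD('a) - 1) = 1"
  using assms mult_char_power[of \<chi> x "CARD('a) - 1"] unit_power_card[of x]
  by (simp add: mult_char_1)

lemma norm_mult_char:
  fixes \<chi> :: "'a::{field,finite} \<Rightarrow> complex"
  assumes "\<chi> \<in> mult_chars" "x \<noteq> 0"
  shows "norm (\<chi> x) = 1"
  using power_eq_1_iff[OF mult_char_root_of_unity[OF assms]] card_field_gt_1[where 'a = 'a]
  by simp

text \<open>On units the value has modulus 1 as a root of unity; at 0 both sides vanish since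
  \<open>inverse 0 = 0\<close>.\<close>

lemma cnj_mult_char:
  fixes \<chi> :: "'a::{field,finite} \<Rightarrow> complex"
  assumes "\<chi> \<in> mult_chars"
  shows "cnj (\<chi> x) = inverse (\<chi> x)"
proof (cases "x = 0")
  case True
  thus ?thesis by (simp add: mult_char_0[OF assms])
next
  case False
  have "\<chi> x * cnj (\<chi> x) = 1"
    using norm_mult_char[OF assms False] by (simp flip: complex_norm_square)
  thus ?thesis using inverse_unique by metis
qed

section \<open>Closure properties and finiteness of the set of characters\<close>

lemma char_cnj_mult_chars: "\<chi> \<in> mult_chars \<Longrightarrow> char_cnj \<chi> \<in> mult_chars"
  by (auto simp: mult_chars_def char_cnj_def)

lemma char_pow_mult_chars: "\<chi> \<in> mult_chars \<Longrightarrow> char_pow \<chi> k \<in> mult_chars"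
  by (auto simp: mult_chars_def char_pow_def power_int_mult_distrib)

lemma mult_mult_chars:
  "\<chi> \<in> mult_chars \<Longrightarrow> \<psi> \<in> mult_chars \<Longrightarrow> (\<lambda>x. \<chi> x * \<psi> x) \<in> mult_chars"
  by (auto simp: mult_chars_def)

text \<open>The factor \<open>\<psi>\<close> provides the value \<open>0\<close> at \<open>0\<close> when \<open>I\<close> is empty.\<close>
lemma mult_prod_mult_chars:
  assumes "\<psi> \<in> mult_chars" "\<And>i. i \<in> I \<Longrightarrow> \<chi> i \<in> mult_chars"
  shows "(\<lambda>x. \<psi> x * (\<Prod>i\<in>I. \<chi> i x)) \<in> mult_chars"
  using assms(2)
proof (induction I rule: infinite_finite_induct)
  case (insert i I)
  hence "(\<lambda>x. \<chi> i x * (\<psi> x * (\<Prod>i\<in>I. \<chi> i x))) \<in> mult_chars"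
    by (intro mult_mult_chars[of "\<chi> i"]) auto
  with insert show ?case
    by (simp add: mult.left_commute)
qed (use assms(1) in simp_all)

text \<open>On units the values are roots of unity of order dividing q - 1 > 0, so only finitely
  many values are possible on a finite domain.\<close>

lemma finite_mult_chars: "finite (mult_chars :: ('a::{field,finite} \<Rightarrow> complex) set)"
proof (rule finite_subset)
  let ?R = "insert 0 {z::complex. z ^ (CARD('a) - 1) = 1}"
  show "mult_chars \<subseteq> ((UNIV :: 'a set) \<rightarrow>\<^sub>E ?R)"
  proof
    fix \<chi> :: "'a \<Rightarrow> complex" assume "\<chi> \<in> mult_chars"
    hence "\<chi> x \<in> ?R" for x
      by (cases "x = 0") (simp_all add: mult_char_0 mult_char_root_of_unity[unfolded One_nat_def])
    thus "\<chi> \<in> (UNIV :: 'a set) \<rightarrow>\<^sub>E ?R" by auto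
  qed
  show "finite ((UNIV :: 'a set) \<rightarrow>\<^sub>E ?R)"
    using card_field_gt_1[where 'a = 'a] by (intro finite_PiE) (auto intro!: finite_roots_unity)
qed

section \<open>Orthogonality relations\<close>

lemma sum_units_mult_left:
  fixes f :: "'a::{field,finite} \<Rightarrow> complex"
  assumes "u \<noteq> 0"
  shows "(\<Sum>x\<in>-{0}. f (u * x)) = (\<Sum>x\<in>-{0}. f x)"
proof -
  have "bij_betw ((*) u) (-{0}) (-{0})"
    by (rule bij_betw_byWitness[where f' = "\<lambda>y. y / u"]) (use assms in auto)
  thus ?thesis by (rule sum.reindex_bij_betw)
qed

text \<open>If \<open>\<chi> u \<noteq> 1\<close>, the substitution of \<open>u * x\<close> for
  \<open>x\<close> preserves the sum but multiplies it by \<open>\<chi> u\<close>, so the sum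
  vanishes.\<close>

lemma sum_mult_char:
  fixes \<chi> :: "'a::{field,finite} \<Rightarrow> complex"
  assumes "\<chi> \<in> mult_chars"
  shows "(\<Sum>x\<in>-{0}. \<chi> x) = (if \<forall>x\<in>-{0}. \<chi> x = 1 then of_nat (CARD('a) - 1) else 0)"
proof (cases "\<forall>x\<in>-{0}. \<chi> x = 1")
  case True
  thus ?thesis by (simp add: card_units)
next
  case False
  then obtain u where u: "u \<noteq> 0" "\<chi> u \<noteq> 1" by auto
  have "\<chi> u * (\<Sum>x\<in>-{0}. \<chi> x) = (\<Sum>x\<in>-{0}. \<chi> x)"
    using sum_units_mult_left[OF u(1), of \<chi>] by (simp add: mult_char_mult[OF assms] sum_distrib_left)
  with u(2) have "(\<Sum>x\<in>-{0}. \<chi> x) = 0" by simp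
  with False show ?thesis by (simp only: if_False)
qed

section \<open>Cyclicity of the unit group and separation of its points by characters\<close>

lemma finite_field_units_generator:
  obtains g :: "'a::{field,finite}" where "\<And>x. x \<noteq> 0 \<Longrightarrow> \<exists>i::nat. x = g ^ i"
proof -
  \<comment> \<open>The type class field is repackaged as a record, so that the algebraic theorem on
    generators of the unit group of a finite field applies.\<close>
  let ?R = "\<lparr>carrier = UNIV, monoid.mult = (*), one = 1, ring.zero = 0, add = (+)\<rparr> :: 'a ring"
  have "\<exists>y. x + y = 0" for x :: 'a
    by (rule exI[of _ "- x"]) simp
  moreover have "\<exists>y. x * y = 1" if "x \<noteq> 0" for x :: 'a
    using that by (intro exI[of _ "inverse x"]) simp
  ultimately interpret R: field ?R
    by unfold_locales (auto simp: algebra_simps Units_def)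
  have carrier: "carrier (mult_of ?R) = -{0}"
    by auto
  have pow: "x [^]\<^bsub>?R\<^esub> i = x ^ i" for x :: 'a and i :: nat
    by (induction i) simp_all
  have "finite (carrier ?R)" by simp
  from R.finite_field_mult_group_has_gen[OF this] obtain g
    where "carrier (mult_of ?R) = {g [^]\<^bsub>?R\<^esub> i | i::nat. i \<in> UNIV}" by blast
  hence "-{0} = {g ^ i | i::nat. True}"
    unfolding carrier pow by simp
  thus ?thesis by (intro that[of g]) blast
qed

text \<open>Sending a generator \<open>g\<close> of the cyclic unit group to a primitive root of
  unity of order q - 1 defines an injective character, which takes the value 1 only at 1.\<close>

lemma mult_char_separates:
  fixes z :: "'a::{field,finite}"
  assumes "z \<noteq> 0" "z \<noteq> 1"
  obtains \<chi> where "\<chi> \<in> mult_chars" "\<chi> z \<noteq> 1"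
proof -
  define m where "m = CARD('a) - 1"
  have m: "m > 0" using card_field_gt_1[where 'a = 'a] by (simp add: m_def)
  obtain g :: 'a where g: "\<And>x. x \<noteq> 0 \<Longrightarrow> \<exists>i::nat. x = g ^ i"
    by (rule finite_field_units_generator) blast
  \<comment> \<open>The powers of 0 are only 0 and 1, but \<open>z\<close> is neither.\<close>
  have g0: "g \<noteq> 0"
  proof
    assume "g = 0"
    with g[OF assms(1)] assms show False by (auto simp: power_0_left split: if_splits)
  qed
  have gm: "g ^ m = 1" using unit_power_card[OF g0] by (simp add: m_def)
  have gmod: "g ^ i = g ^ (i mod m)" for i
    by (subst div_mult_mod_eq[of i m, symmetric])
       (simp only: power_add power_mult[of g m] mult.commute[of "i div m"] gm power_one mult_1_left)
  have "(\<lambda>i. g ^ i) ` {..<m} = -{0}"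
  proof (intro equalityI subsetI)
    fix x assume "x \<in> -{0::'a}"
    then obtain i where "x = g ^ i" using g by blast
    thus "x \<in> (\<lambda>i. g ^ i) ` {..<m}" using gmod[of i] m by auto
  qed (use g0 in auto)
  \<comment> \<open>A map from \<open>m\<close> exponents onto \<open>m\<close> units is injective,
    so \<open>g\<close> has order exactly \<open>m\<close>.\<close>
  hence inj: "inj_on (\<lambda>i. g ^ i) {..<m}"
    by (intro eq_card_imp_inj_on) (simp_all add: card_units m_def)
  define \<zeta> where "\<zeta> = cis (2 * pi / real m)"
  have \<zeta>pow: "\<zeta> ^ k = cis (2 * pi * real k / real m)" for k
    by (simp add: \<zeta>_def DeMoivre mult_ac)
  have \<zeta>m: "\<zeta> ^ m = 1" using m by (simp add: \<zeta>pow)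
  have \<zeta>mod: "\<zeta> ^ i = \<zeta> ^ (i mod m)" for i
    by (subst div_mult_mod_eq[of i m, symmetric])
       (simp only: power_add power_mult[of \<zeta> m] mult.commute[of "i div m"] \<zeta>m power_one mult_1_left)
  have \<zeta>cong: "\<zeta> ^ i = \<zeta> ^ j" if "g ^ i = g ^ j" for i j
  proof -
    have "i mod m = j mod m"
      using that gmod[of i] gmod[of j] m by (intro inj_onD[OF inj]) auto
    thus ?thesis using \<zeta>mod by metis
  qed
  \<comment> \<open>The exponent of \<open>x\<close> is unique only modulo \<open>m\<close>; by
    \<open>\<zeta>cong\<close> the choice made by \<open>SOME\<close> does not affect the
    value.\<close>
  define \<chi> where "\<chi> = (\<lambda>x. if x = 0 then 0 else \<zeta> ^ (SOME i. x = g ^ i))"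
  have \<chi>: "\<chi> (g ^ i) = \<zeta> ^ i" for i
  proof -
    have "g ^ i = g ^ (SOME j. g ^ i = g ^ j)" by (rule someI) (rule refl)
    from \<zeta>cong[OF this] show ?thesis using g0 by (simp add: \<chi>_def)
  qed
  have "\<chi> (x * y) = \<chi> x * \<chi> y" if xy: "x \<noteq> 0" "y \<noteq> 0" for x y
  proof -
    obtain i j where "x = g ^ i" "y = g ^ j" using g[OF xy(1)] g[OF xy(2)] by blast
    thus ?thesis by (simp add: \<chi> flip: power_add)
  qed
  hence "\<chi> \<in> mult_chars" by (auto simp: mult_chars_def \<chi>_def \<zeta>_def)
  moreover have "\<chi> z \<noteq> 1"
  proof
    assume one: "\<chi> z = 1"
    obtain i where i: "z = g ^ i" using g assms by blast
    \<comment> \<open>Since \<open>\<zeta>\<close> is primitive, its powers below \<open>m\<close>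
      are distinct, so \<open>i mod m = 0\<close> and \<open>z = g ^ 0\<close>.\<close>
    have "\<zeta> ^ (i mod m) = \<zeta> ^ 0" using one by (simp add: i \<chi> flip: \<zeta>mod)
    moreover have "inj_on (\<lambda>k. \<zeta> ^ k) {..<m}"
      using bij_betw_roots_unity[OF m] by (simp add: bij_betw_def \<zeta>pow)
    ultimately have "i mod m = 0" using m by (elim inj_onD) simp_all
    hence "z = 1" using i gmod[of i] by simp
    with assms(2) show False by simp
  qed
  ultimately show ?thesis by (rule that)
qed

text \<open>Dual of the argument for \<open>sum_mult_char\<close>: multiplication by a character
  \<open>\<psi>\<close> with \<open>\<psi> z \<noteq> 1\<close> permutes \<open>mult_chars\<close>,
  so the sum equals \<open>\<psi> z\<close> times itself.\<close>

lemma sum_mult_chars_neq_1: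
  fixes z :: "'a::{field,finite}"
  assumes "z \<noteq> 0" "z \<noteq> 1"
  shows "(\<Sum>\<chi>\<in>mult_chars. \<chi> z) = (0 :: complex)"
proof -
  obtain \<psi> where \<psi>: "\<psi> \<in> mult_chars" "\<psi> z \<noteq> 1"
    using mult_char_separates[OF assms] by blast
  let ?h = "\<lambda>\<psi> \<chi>. \<lambda>x::'a. \<psi> x * \<chi> x :: complex"
  have inv: "char_cnj \<psi> x * \<psi> x = 1" if "x \<noteq> 0" for x
    using mult_char_nonzero[OF \<psi>(1) that] by (simp add: char_cnj_def cnj_mult_char[OF \<psi>(1)])
  \<comment> \<open>The bijection needs equality of functions on the whole field; at 0, where
    \<open>\<psi>\<close> cannot be cancelled, both sides are 0.\<close>
  have cancel: "char_cnj \<psi> x * (\<psi> x * \<chi> x) = \<chi> x" if "\<chi> \<in> mult_chars" for \<chi> x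
    using inv[of x] mult_char_0[OF that] by (cases "x = 0") (simp_all flip: mult.assoc)
  hence cancel': "\<psi> x * (char_cnj \<psi> x * \<chi> x) = \<chi> x" if "\<chi> \<in> mult_chars" for \<chi> x
    using that by (metis mult.left_commute)
  have "bij_betw (?h \<psi>) mult_chars mult_chars"
    by (rule bij_betw_byWitness[where f' = "?h (char_cnj \<psi>)"])
       (auto simp: cancel cancel' intro!: mult_mult_chars \<psi>(1) char_cnj_mult_chars)
  hence "(\<Sum>\<chi>\<in>mult_chars. \<psi> z * \<chi> z) = (\<Sum>\<chi>\<in>mult_chars. \<chi> z)"
    by (rule sum.reindex_bij_betw[where g = "\<lambda>\<chi>. \<chi> z"])
  thus ?thesis using \<psi>(2) by (simp flip: sum_distrib_left)
qed

text \<open>Double counting of \<open>\<Sum>\<chi>. \<Sum>z. \<chi> z\<close> by the two orthogonality relations.\<close>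
lemma card_mult_chars:
  "card (mult_chars :: ('a::{field,finite} \<Rightarrow> complex) set) = CARD('a) - 1"
proof -
  let ?M = "mult_chars :: ('a \<Rightarrow> complex) set"
  \<comment> \<open>The trivial character, with the conventional value 0 at 0.\<close>
  let ?e = "\<lambda>x::'a. if x = 0 then 0 else (1::complex)"
  have e: "?e \<in> ?M" by (auto simp: mult_chars_def)
  have triv: "(\<forall>x\<in>-{0}. \<chi> x = 1) \<longleftrightarrow> \<chi> = ?e" if "\<chi> \<in> ?M" for \<chi>
    using mult_char_0[OF that] by (auto simp: fun_eq_iff)
  have "of_nat (card ?M) = (\<Sum>\<chi>\<in>?M. \<chi> 1)"
    by (simp add: mult_char_1)
  also have "\<dots> = (\<Sum>z\<in>-{0}. \<Sum>\<chi>\<in>?M. \<chi> z)"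
    by (subst sum.remove[of "-{0}" 1]) (auto intro: sum.neutral simp: sum_mult_chars_neq_1)
  also have "\<dots> = (\<Sum>\<chi>\<in>?M. \<Sum>z\<in>-{0}. \<chi> z)"
    by (rule sum.swap)
  also have "\<dots> = (\<Sum>\<chi>\<in>?M. if \<chi> = ?e then of_nat (CARD('a) - 1) else 0)"
    by (rule sum.cong) (simp_all only: sum_mult_char triv)
  also have "\<dots> = of_nat (CARD('a) - 1)"
    using e by (simp add: finite_mult_chars)
  finally show ?thesis by (simp only: of_nat_eq_iff)
qed

lemma sum_mult_chars:
  fixes z :: "'a::{field,finite}"
  assumes "z \<noteq> 0"
  shows "(\<Sum>\<chi>\<in>mult_chars. \<chi> z) = (if z = 1 then of_nat (CARD('a) - 1) else (0 :: complex))"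
  using sum_mult_chars_neq_1[OF assms] by (simp add: mult_char_1 card_mult_chars)

section \<open>Exponential sums\<close>

text \<open>Expanding the Gauss sum turns the conjugate value at \<open>x\<close> times
  \<open>\<chi> y\<close> into \<open>\<chi> (inverse x * y)\<close>; summing over characters leaves
  only the term \<open>x = y\<close>.\<close>

lemma fourier_inversion_units:
  fixes \<Psi> :: "'a::{field,finite} \<Rightarrow> complex"
  assumes "y \<noteq> 0"
  shows "(\<Sum>\<chi>\<in>mult_chars. gauss_sum \<Psi> (char_cnj \<chi>) * \<chi> y) = of_nat (CARD('a) - 1) * \<Psi> y"
proof -
  have "(\<Sum>\<chi>\<in>mult_chars. gauss_sum \<Psi> (char_cnj \<chi>) * \<chi> y)
      = (\<Sum>\<chi>\<in>mult_chars. \<Sum>x\<in>-{0}. \<Psi> x * \<chi> (inverse x * y))"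
    by (intro sum.cong refl)
       (simp add: gauss_sum_def char_cnj_def cnj_mult_char mult_char_mult mult_char_inverse
          sum_distrib_right sum_distrib_left mult_ac)
  also have "\<dots> = (\<Sum>x\<in>-{0}. \<Psi> x * (\<Sum>\<chi>\<in>mult_chars. \<chi> (inverse x * y)))"
    by (subst sum.swap) (simp add: sum_distrib_left)
  also have "\<dots> = (\<Sum>x\<in>-{0}. if x = y then of_nat (CARD('a) - 1) * \<Psi> y else 0)"
    using assms by (intro sum.cong refl) (auto simp: sum_mult_chars field_simps)
  also have "\<dots> = of_nat (CARD('a) - 1) * \<Psi> y"
    using assms by simp
  finally show ?thesis .
qed

lemma add_char_sum:
  assumes "add_char \<Psi>"
  shows "\<Psi> (\<Sum>i\<in>I. f i) = (\<Prod>i\<in>I. \<Psi> (f i))"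
proof -
  have add: "\<Psi> (x + y) = \<Psi> x * \<Psi> y" and "\<Psi> x \<noteq> 0" for x y
    using assms by (simp_all add: add_char_def)
  with add[of 0 0] have "\<Psi> 0 = 1" by simp
  thus ?thesis
    by (induction I rule: infinite_finite_induct) (simp_all add: add)
qed

text \<open>Orthogonality for the product of the powers divided by \<open>\<psi>\<close>. With
  \<psi> the j-th entry of \<beta>, the case distinction is the j-th condition in
  \<open>L_set\<close>.\<close>

lemma sum_cnj_mult_prod_char_pow:
  fixes \<psi> :: "'a::{field,finite} \<Rightarrow> complex"
  assumes "\<psi> \<in> mult_chars" "\<And>i. i \<in> I \<Longrightarrow> \<chi> i \<in> mult_chars"
  shows "(\<Sum>x\<in>-{0}. char_cnj \<psi> x * (\<Prod>i\<in>I. char_pow (\<chi> i) (k i) x)) =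
    (if \<forall>x\<in>-{0}. (\<Prod>i\<in>I. char_pow (\<chi> i) (k i) x) = \<psi> x then of_nat (CARD('a) - 1) else 0)"
proof -
  have "char_cnj \<psi> x * w = 1 \<longleftrightarrow> w = \<psi> x" if "x \<in> -{0}" for x w
    using that mult_char_nonzero[OF assms(1), of x]
    by (auto simp: char_cnj_def cnj_mult_char[OF assms(1)] field_simps)
  moreover have "(\<lambda>x. char_cnj \<psi> x * (\<Prod>i\<in>I. char_pow (\<chi> i) (k i) x)) \<in> mult_chars"
    using assms by (intro mult_prod_mult_chars char_cnj_mult_chars char_pow_mult_chars)
  ultimately show ?thesis
    by (subst sum_mult_char) simp_all
qed

text \<open>Characters are multiplicative, so the summand splits into factors that each involve one
  coordinate \<open>x j\<close>. The sum over tuples becomes a product of \<open>n\<close>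
  one-variable sums, each q - 1 or 0.\<close>

lemma sum_cnj_mult_prod_monom_eval:
  fixes \<beta> :: "nat \<Rightarrow> 'a::{field,finite} \<Rightarrow> complex"
  assumes \<beta>: "\<beta> \<in> {1..n} \<rightarrow> mult_chars" and \<chi>: "\<chi> \<in> {1..N} \<rightarrow>\<^sub>E mult_chars"
  shows "(\<Sum>x\<in>{1..n} \<rightarrow>\<^sub>E -{0}.
      (\<Prod>j\<in>{1..n}. char_cnj (\<beta> j) (x j)) * (\<Prod>i\<in>{1..N}. \<chi> i (monom_eval n x (a i)))) =
    (if \<chi> \<in> L_set n N a \<beta> then of_nat (CARD('a) - 1) ^ n else 0)"
proof -
  let ?c = "\<lambda>j x. \<Prod>i\<in>{1..N}. char_pow (\<chi> i) (a i j) x"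
  have \<chi>': "\<chi> i \<in> mult_chars" if "i \<in> {1..N}" for i
    using \<chi> that by auto
  have "(\<Prod>i\<in>{1..N}. \<chi> i (monom_eval n x (a i))) = (\<Prod>j\<in>{1..n}. ?c j (x j))"
    if x: "x \<in> {1..n} \<rightarrow>\<^sub>E -{0}" for x :: "nat \<Rightarrow> 'a"
  proof -
    have "(\<Prod>i\<in>{1..N}. \<chi> i (monom_eval n x (a i)))
        = (\<Prod>i\<in>{1..N}. \<Prod>j\<in>{1..n}. char_pow (\<chi> i) (a i j) (x j))"
    proof (rule prod.cong[OF refl])
      fix i assume "i \<in> {1..N}"
      moreover have "x j \<noteq> 0" if "j \<in> {1..n}" for j
        using PiE_mem[OF x that] by simp
      ultimately show "\<chi> i (monom_eval n x (a i)) = (\<Prod>j\<in>{1..n}. char_pow (\<chi> i) (a i j) (x j))"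
        using \<chi>' by (simp add: monom_eval_def mult_char_prod mult_char_powi char_pow_def)
    qed
    thus ?thesis by (simp only: prod.swap[of _ "{1..n}"])
  qed
  hence "(\<Sum>x\<in>{1..n} \<rightarrow>\<^sub>E -{0}.
      (\<Prod>j\<in>{1..n}. char_cnj (\<beta> j) (x j)) * (\<Prod>i\<in>{1..N}. \<chi> i (monom_eval n x (a i))))
    = (\<Sum>x\<in>{1..n} \<rightarrow>\<^sub>E -{0}. \<Prod>j\<in>{1..n}. char_cnj (\<beta> j) (x j) * ?c j (x j))"
    by (intro sum.cong refl) (simp only: prod.distrib)
  also have "\<dots> = (\<Prod>j\<in>{1..n}. \<Sum>y\<in>-{0}. char_cnj (\<beta> j) y * ?c j y)"
    by (rule prod_sum_PiE[symmetric]) simp_all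
  also have "\<dots> = (\<Prod>j\<in>{1..n}. if \<forall>y\<in>-{0}. ?c j y = \<beta> j y then of_nat (CARD('a) - 1) else 0)"
    using \<beta> \<chi>' by (intro prod.cong refl sum_cnj_mult_prod_char_pow) auto
  \<comment> \<open>One failing coordinate annihilates the whole product.\<close>
  also have "\<dots> = (if \<forall>j\<in>{1..n}. \<forall>y\<in>-{0}. ?c j y = \<beta> j y then of_nat (CARD('a) - 1) ^ n else 0)"
    by (auto intro!: prod_zero)
  finally show ?thesis using \<chi> by (simp add: L_set_def)
qed

theorem theorem1p3:
  fixes \<Psi> :: "'a::{field,finite} \<Rightarrow> complex"
    and n N :: nat
    and a :: "nat \<Rightarrow> nat \<Rightarrow> int"
    and \<beta> :: "nat \<Rightarrow> 'a \<Rightarrow> complex"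
    and l :: "nat \<Rightarrow> 'a"
  assumes "nontrivial_add_char \<Psi>"
    and "n \<ge> 1" and "N \<ge> 1"
    and "\<beta> \<in> {1..n} \<rightarrow> mult_chars"
    and "l \<in> {1..N} \<rightarrow> -{0}"
  shows "S_A \<Psi> n N a \<beta> l = F_A \<Psi> n N a \<beta> l"
proof -
  \<comment> \<open>The orthogonality lemmas subtract 1 in the naturals, \<open>F_A\<close> in the
    complex numbers; the two agree because q > 1.\<close>
  define q1 :: complex where "q1 = of_nat (CARD('a) - 1)"
  have q1: "q1 = of_nat CARD('a) - 1" "q1 \<noteq> 0"
    using card_field_gt_1[where 'a = 'a] by (simp_all add: q1_def of_nat_diff)
  let ?X = "{1..n} \<rightarrow>\<^sub>E -{0::'a}"
  let ?C = "{1..N} \<rightarrow>\<^sub>E (mult_chars :: ('a \<Rightarrow> complex) set)"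
  \<comment> \<open>\<open>B\<close> depends only on the point and \<open>G\<close> only on the
    characters, so each moves freely when the two sums are exchanged.\<close>
  define B where "B = (\<lambda>x. \<Prod>j\<in>{1..n}. char_cnj (\<beta> j) (x j))"
  define G where "G = (\<lambda>\<chi>. (\<Prod>i\<in>{1..N}. gauss_sum \<Psi> (char_cnj (\<chi> i))) * (\<Prod>i\<in>{1..N}. \<chi> i (l i)))"
  have add: "add_char \<Psi>"
    using assms(1) by (simp add: nontrivial_add_char_def)
  have expand: "q1 ^ N * \<Psi> (\<Sum>i\<in>{1..N}. l i * monom_eval n x (a i))
      = (\<Sum>\<chi>\<in>?C. G \<chi> * (\<Prod>i\<in>{1..N}. \<chi> i (monom_eval n x (a i))))" if x: "x \<in> ?X" for x
  proof -
    have "x j \<noteq> 0" if "j \<in> {1..n}" for j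
      using PiE_mem[OF x that] by simp
    \<comment> \<open>Fourier inversion holds at units; this is where the entries of \<lambda> must
      be nonzero.\<close>
    hence nz: "l i * monom_eval n x (a i) \<noteq> 0" if "i \<in> {1..N}" for i
      using assms(5) that by (auto simp: monom_eval_def)
    have "q1 ^ N * \<Psi> (\<Sum>i\<in>{1..N}. l i * monom_eval n x (a i))
        = (\<Prod>i\<in>{1..N}. q1 * \<Psi> (l i * monom_eval n x (a i)))"
      by (simp add: add_char_sum[OF add] prod.distrib)
    also have "\<dots> = (\<Prod>i\<in>{1..N}. \<Sum>\<chi>\<in>mult_chars.
        gauss_sum \<Psi> (char_cnj \<chi>) * \<chi> (l i * monom_eval n x (a i)))"
      unfolding q1_def
      by (intro prod.cong refl fourier_inversion_units[symmetric] nz)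
    also have "\<dots> = (\<Sum>\<chi>\<in>?C. \<Prod>i\<in>{1..N}.
        gauss_sum \<Psi> (char_cnj (\<chi> i)) * \<chi> i (l i * monom_eval n x (a i)))"
      by (rule prod_sum_PiE) (simp_all add: finite_mult_chars)
    also have "\<dots> = (\<Sum>\<chi>\<in>?C. G \<chi> * (\<Prod>i\<in>{1..N}. \<chi> i (monom_eval n x (a i))))"
    proof (rule sum.cong[OF refl])
      fix \<chi> assume "\<chi> \<in> ?C"
      hence "(\<Prod>i\<in>{1..N}. gauss_sum \<Psi> (char_cnj (\<chi> i)) * \<chi> i (l i * monom_eval n x (a i)))
          = (\<Prod>i\<in>{1..N}. gauss_sum \<Psi> (char_cnj (\<chi> i)) * (\<chi> i (l i) * \<chi> i (monom_eval n x (a i))))"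
        by (intro prod.cong refl arg_cong2[where f = "(*)"] mult_char_mult) auto
      thus "(\<Prod>i\<in>{1..N}. gauss_sum \<Psi> (char_cnj (\<chi> i)) * \<chi> i (l i * monom_eval n x (a i)))
          = G \<chi> * (\<Prod>i\<in>{1..N}. \<chi> i (monom_eval n x (a i)))"
        by (simp add: G_def prod.distrib mult.assoc)
    qed
    finally show ?thesis .
  qed
  \<comment> \<open>The factor \<open>q1 ^ N\<close> supplies one \<open>q1\<close> for each of the
    \<open>N\<close> Fourier inversions.\<close>
  have "q1 ^ N * S_A \<Psi> n N a \<beta> l
      = (\<Sum>x\<in>?X. B x * (q1 ^ N * \<Psi> (\<Sum>i\<in>{1..N}. l i * monom_eval n x (a i))))"
    by (simp add: S_A_def B_def sum_distrib_left mult.left_commute)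
  also have "\<dots> = (\<Sum>x\<in>?X. \<Sum>\<chi>\<in>?C. G \<chi> * (B x * (\<Prod>i\<in>{1..N}. \<chi> i (monom_eval n x (a i)))))"
    by (intro sum.cong refl) (simp only: expand sum_distrib_left mult.left_commute)
  also have "\<dots> = (\<Sum>\<chi>\<in>?C. G \<chi> * (\<Sum>x\<in>?X. B x * (\<Prod>i\<in>{1..N}. \<chi> i (monom_eval n x (a i)))))"
    by (subst sum.swap) (simp only: sum_distrib_left)
  also have "\<dots> = (\<Sum>\<chi>\<in>?C. if \<chi> \<in> L_set n N a \<beta> then q1 ^ n * G \<chi> else 0)"
    unfolding B_def
    by (intro sum.cong refl)
       (simp only: sum_cnj_mult_prod_monom_eval[OF assms(4)] q1_def[symmetric], simp)
  also have "\<dots> = (\<Sum>\<chi>\<in>L_set n N a \<beta>. q1 ^ n * G \<chi>)"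
    by (rule sum.mono_neutral_cong_right) (auto simp: finite_mult_chars finite_PiE L_set_def)
  \<comment> \<open>The exponent \<open>int n - int N\<close> balances \<open>n\<close> factors from
    orthogonality against \<open>N\<close> from inversion.\<close>
  also have "\<dots> = q1 ^ N * F_A \<Psi> n N a \<beta> l"
    using q1(2) by (simp add: F_A_def G_def sum_distrib_left power_int_diff flip: q1(1))
  finally show ?thesis using q1(2) by simp
qed

end
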